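(* Let $1<p<\infty$, let $a_0,c\in\mathbb C$, and let $T\in\mathcal L(\ell_p(\mathbb N_0))$ be given by $T:=a_0I+c(S_R+S_L)$. Define $$E_p:=\Bigl\{rs^{p-1}e^{-i\theta}+sr^{p-1}e^{i\theta}:\ r,s\ge0,\ r^p+s^p=1,\ \theta\in[0,2\pi]\Bigr\}.$$ Then $$W_e(T)=\overline{W(T)}=a_0+2c\,\overline{\operatorname{conv}}\,E_p.$$ In particular, for $T_1:=S_R+S_L$ one has $W_e(T_1)=\overline{W(T_1)}=2\,\overline{\operatorname{conv}}\,E_p$.
   Context: $\mathbb N_0=\{0,1,2,\dots\}$ and $(e_j)_{j\ge0}$ is the standard basis of the complex space $\ell_p(\mathbb N_0)$. The right and left shifts on $\ell_p(\mathbb N_0)$ are given by $S_Re_j=e_{j+1}$ $(j\ge0)$, $S_Le_0=0$, $S_Le_j=e_{j-1}$ $(j\ge1)$. $\overline{\operatorname{conv}}$ denotes the closed convex hull, and the bar denotes closure in $\mathbb C$. With $1/p+1/q=1$, the dual of $\ell_p(\mathbb N_0)$ is identified with $\ell_q(\mathbb N_0)$ via $\langle x,y\rangle=\sum_j x_j\overline{y_j}$. For $x=(x_j)$ put $J(x)=(x_j|x_j|^{p-2})_j$ (with $0$ in the coordinates where $x_j=0$). The numerical range is $W(T)=\{\langle Tx,J(x)\rangle:\ \|x\|_p=1\}$. The essential numerical range $W_e(T)$ is the set of all $\lambda\in\mathbb C$ for which there is a net (equivalently, a sequence) of unit vectors $x_\alpha$ with $x_\alpha\to0$ weakly and $\langle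 Tx_\alpha,J(x_\alpha)\rangle\to\lambda$. *)

theory Defs
  imports "HOL-Analysis.Analysis"
begin

section \<open>The complex sequence space \<open>\<ell>\<^sub>p(\<nat>)\<close>\<close>

definition ell :: "real \<Rightarrow> (nat \<Rightarrow> complex) set" where
  "ell p = {x. summable (\<lambda>j. norm (x j) powr p)}"

definition ell_norm :: "real \<Rightarrow> (nat \<Rightarrow> complex) \<Rightarrow> real" where
  "ell_norm p x = (\<Sum>j. norm (x j) powr p) powr (1 / p)"

definition ell_basis :: "nat \<Rightarrow> nat \<Rightarrow> complex" where
  "ell_basis k = (\<lambda>j. if j = k then 1 else 0)"

definition ell_linear_functional :: "real \<Rightarrow> ((nat \<Rightarrow> complex) \<Rightarrow> complex) \<Rightarrow> bool" where
  "ell_linear_functional p f \<longleftrightarrow>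
     (\<forall>x\<in>ell p. \<forall>y\<in>ell p. f (\<lambda>j. x j + y j) = f x + f y) \<and>
     (\<forall>x\<in>ell p. \<forall>a. f (\<lambda>j. a * x j) = a * f x)"

definition ell_dual :: "real \<Rightarrow> ((nat \<Rightarrow> complex) \<Rightarrow> complex) set" where
  "ell_dual p = {f. ell_linear_functional p f \<and>
     (\<exists>C. \<forall>x\<in>ell p. norm (f x) \<le> C * ell_norm p x)}"

definition ell_weakly_null :: "real \<Rightarrow> (nat \<Rightarrow> nat \<Rightarrow> complex) \<Rightarrow> bool" where
  "ell_weakly_null p X \<longleftrightarrow> (\<forall>f\<in>ell_dual p. (\<lambda>n. f (X n)) \<longlonglongrightarrow> 0)"

text \<open>The bounded linear operators on \<open>\<ell>\<^sub>p\<close>; only the values on \<^term>\<open>ell p\<close> matter.\<close>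

definition ell_operators :: "real \<Rightarrow> ((nat \<Rightarrow> complex) \<Rightarrow> (nat \<Rightarrow> complex)) set" where
  "ell_operators p = {T. (\<forall>x\<in>ell p. T x \<in> ell p) \<and>
     (\<forall>x\<in>ell p. \<forall>y\<in>ell p. T (\<lambda>j. x j + y j) = (\<lambda>j. T x j + T y j)) \<and>
     (\<forall>x\<in>ell p. \<forall>a. T (\<lambda>j. a * x j) = (\<lambda>j. a * T x j)) \<and>
     (\<exists>C. \<forall>x\<in>ell p. ell_norm p (T x) \<le> C * ell_norm p x)}"


section \<open>Numerical ranges\<close>

definition ell_pairing :: "(nat \<Rightarrow> complex) \<Rightarrow> (nat \<Rightarrow> complex) \<Rightarrow> complex" where
  "ell_pairing x y = (\<Sum>j. x j * cnj (y j))"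

definition duality_map :: "real \<Rightarrow> (nat \<Rightarrow> complex) \<Rightarrow> (nat \<Rightarrow> complex)" where
  "duality_map p x =
     (\<lambda>j. if x j = 0 then 0 else x j * complex_of_real (norm (x j) powr (p - 2)))"

definition numerical_range ::
  "real \<Rightarrow> ((nat \<Rightarrow> complex) \<Rightarrow> (nat \<Rightarrow> complex)) \<Rightarrow> complex set" where
  "numerical_range p T =
     {ell_pairing (T x) (duality_map p x) | x. x \<in> ell p \<and> ell_norm p x = 1}"

definition ess_numerical_range ::
  "real \<Rightarrow> ((nat \<Rightarrow> complex) \<Rightarrow> (nat \<Rightarrow> complex)) \<Rightarrow> complex set" where
  "ess_numerical_range p T =
     {z. \<exists>X. (\<forall>n. X n \<in> ell p \<and> ell_norm p (X n) = 1) \<and>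
             ell_weakly_null p X \<and>
             (\<lambda>n. ell_pairing (T (X n)) (duality_map p (X n))) \<longlonglongrightarrow> z}"


section \<open>Shifts\<close>

definition shift_right :: "(nat \<Rightarrow> complex) \<Rightarrow> (nat \<Rightarrow> complex)" where
  "shift_right x = (\<lambda>j. case j of 0 \<Rightarrow> 0 | Suc i \<Rightarrow> x i)"

definition shift_left :: "(nat \<Rightarrow> complex) \<Rightarrow> (nat \<Rightarrow> complex)" where
  "shift_left x = (\<lambda>j. x (Suc j))"

lemma shift_right_basis: "shift_right (ell_basis j) = ell_basis (Suc j)"
  by (auto simp: shift_right_def ell_basis_def fun_eq_iff split: nat.splits)

lemma shift_left_basis_0: "shift_left (ell_basis 0) = (\<lambda>_. 0)"
  by (auto simp: shift_left_def ell_basis_def)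

lemma shift_left_basis: "j \<ge> 1 \<Longrightarrow> shift_left (ell_basis j) = ell_basis (j - 1)"
  by (auto simp: shift_left_def ell_basis_def fun_eq_iff)

text \<open>The coordinatewise formulas define bounded operators on \<open>\<ell>\<^sub>p\<close>, so they are the
  continuous linear extensions of the action on the basis.\<close>

lemma shift_right_sums:
  assumes "x \<in> ell p"
  shows "(\<lambda>j. norm (shift_right x j) powr p) sums (\<Sum>j. norm (x j) powr p)"
proof -
  have "(\<lambda>j. norm (shift_right x (Suc j)) powr p) sums (\<Sum>j. norm (x j) powr p)"
    using assms by (simp add: shift_right_def ell_def summable_sums)
  from sums_Suc[OF this] show ?thesis by (simp add: shift_right_def)
qed

lemma shift_left_summable:
  assumes "x \<in> ell p"
  shows "summable (\<lambda>j. norm (shift_left x j) powr p)"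
    and "(\<Sum>j. norm (shift_left x j) powr p) \<le> (\<Sum>j. norm (x j) powr p)"
proof -
  have s: "summable (\<lambda>j. norm (x j) powr p)" using assms by (simp add: ell_def)
  show "summable (\<lambda>j. norm (shift_left x j) powr p)"
    using s by (simp add: shift_left_def summable_Suc_iff[of "\<lambda>j. norm (x j) powr p"])
  show "(\<Sum>j. norm (shift_left x j) powr p) \<le> (\<Sum>j. norm (x j) powr p)"
    using suminf_split_head[OF s] by (simp add: shift_left_def)
qed

lemma powr_sum3_le:
  fixes a b c p :: real
  assumes "0 \<le> a" "0 \<le> b" "0 \<le> c" "0 < p"
  shows "(a + b + c) powr p \<le> 3 powr p * (a powr p + b powr p + c powr p)"
proof -
  define m where "m = max a (max b c)"
  have "(a + b + c) powr p \<le> (3 * m) powr p"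
    using assms by (intro powr_mono2) (auto simp: m_def)
  also have "\<dots> = 3 powr p * m powr p" using assms by (simp add: powr_mult m_def)
  also have "m powr p \<le> a powr p + b powr p + c powr p"
    by (auto simp: m_def max_def)
  finally show ?thesis by simp
qed

lemma shift_combination_in_ell_operators:
  fixes a c :: complex
  defines "T \<equiv> (\<lambda>x j. a * x j + c * (shift_right x j + shift_left x j))"
  assumes p: "0 < p"
  shows "T \<in> ell_operators p"
proof -
  define K where "K = 3 powr p * (norm a powr p + norm c powr p + norm c powr p)"
  have main: "summable (\<lambda>j. norm (T x j) powr p) \<and>
      (\<Sum>j. norm (T x j) powr p) \<le> K * (\<Sum>j. norm (x j) powr p)"
    if x: "x \<in> ell p" for x
  proof -
    let ?A = "norm a powr p" and ?C = "norm c powr p"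
    let ?g = "\<lambda>j. 3 powr p * (?A * norm (x j) powr p + ?C * norm (shift_right x j) powr p
                 + ?C * norm (shift_left x j) powr p)"
    let ?S = "\<Sum>j. norm (x j) powr p"
    let ?L = "\<Sum>j. norm (shift_left x j) powr p"
    have le: "norm (T x j) powr p \<le> ?g j" for j
    proof -
      have "norm (T x j) \<le>
          norm (a * x j) + norm (c * shift_right x j) + norm (c * shift_left x j)"
        unfolding T_def distrib_left add.assoc[symmetric]
        by (rule norm_triangle_le, rule add_right_mono, rule norm_triangle_ineq)
      then have "norm (T x j) powr p \<le>
          (norm (a * x j) + norm (c * shift_right x j) + norm (c * shift_left x j)) powr p"
        using p by (intro powr_mono2) auto
      also have "\<dots> \<le> 3 powr p * (norm (a * x j) powr p + norm (c * shift_right x j) powr p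
          + norm (c * shift_left x j) powr p)"
        using p by (intro powr_sum3_le) auto
      finally show ?thesis by (simp add: norm_mult powr_mult)
    qed
    have sx: "(\<lambda>j. norm (x j) powr p) sums ?S" using x by (simp add: ell_def summable_sums)
    have sg: "?g sums (3 powr p * (?A * ?S + ?C * ?S + ?C * ?L))"
      by (intro sums_mult sums_add sx shift_right_sums[OF x]
          summable_sums[OF shift_left_summable(1)[OF x]])
    have sT: "summable (\<lambda>j. norm (T x j) powr p)"
      by (rule summable_comparison_test'[OF sums_summable[OF sg], of 0]) (use le in auto)
    have "(\<Sum>j. norm (T x j) powr p) \<le> suminf ?g"
      by (rule suminf_le[OF le sT sums_summable[OF sg]])
    also have "\<dots> = 3 powr p * (?A * ?S + ?C * ?S + ?C * ?L)"
      using sums_unique[OF sg] by simp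
    also have "\<dots> \<le> 3 powr p * (?A * ?S + ?C * ?S + ?C * ?S)"
      using shift_left_summable(2)[OF x] by (intro mult_left_mono add_left_mono) auto
    finally show ?thesis using sT by (simp add: K_def algebra_simps)
  qed
  have "ell_norm p (T x) \<le> K powr (1 / p) * ell_norm p x"
    if x: "x \<in> ell p" for x
  proof -
    have "K \<ge> 0" by (simp add: K_def)
    moreover have "0 \<le> (\<Sum>j. norm (x j) powr p)"
      using x by (intro suminf_nonneg) (auto simp: ell_def)
    moreover have "0 \<le> (\<Sum>j. norm (T x j) powr p)"
      using main[OF x] by (intro suminf_nonneg) auto
    ultimately have "ell_norm p (T x)
        \<le> (K * (\<Sum>j. norm (x j) powr p)) powr (1 / p)"
      unfolding ell_norm_def using main[OF x] p by (intro powr_mono2) auto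
    then show ?thesis
      using \<open>K \<ge> 0\<close> \<open>0 \<le> (\<Sum>j. norm (x j) powr p)\<close> by (simp add: ell_norm_def powr_mult)
  qed
  moreover have "T x \<in> ell p" if "x \<in> ell p" for x
    using main[OF that] by (simp add: ell_def)
  moreover have "T (\<lambda>j. x j + y j) = (\<lambda>j. T x j + T y j)" for x y
    by (auto simp: T_def shift_right_def shift_left_def fun_eq_iff algebra_simps split: nat.splits)
  moreover have "T (\<lambda>j. b * x j) = (\<lambda>j. b * T x j)" for x b
    by (auto simp: T_def shift_right_def shift_left_def fun_eq_iff algebra_simps split: nat.splits)
  ultimately show ?thesis unfolding ell_operators_def by blast
qed


section \<open>The set \<open>E\<^sub>p\<close>\<close>

definition E_set :: "real \<Rightarrow> complex set" where
  "E_set p =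
     {complex_of_real (r * s powr (p - 1)) * exp (- (\<i> * complex_of_real \<theta>)) +
      complex_of_real (s * r powr (p - 1)) * exp (\<i> * complex_of_real \<theta>) | r s \<theta>.
      0 \<le> r \<and> 0 \<le> s \<and> r powr p + s powr p = 1 \<and> 0 \<le> \<theta> \<and> \<theta> \<le> 2 * pi}"

end

theory Submission
  imports Defs
begin

text \<open>
  For \<open>x\<close> in the unit sphere the number \<open>\<langle>T\<^sub>1 x, J(x)\<rangle>\<close> splits into one term for each edge
  \<open>{j, j+1}\<close> of the half-line, namely
  \<open>b(u,v) = u \<cdot> cnj v \<cdot> |v|\<^sup>p\<^sup>-\<^sup>2 + v \<cdot> cnj u \<cdot> |u|\<^sup>p\<^sup>-\<^sup>2\<close> at \<open>u = x\<^sub>j\<close>, \<open>v = x\<^sub>j\<^sub>+\<^sub>1\<close>. This \<open>b\<close> is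
  homogeneous of degree \<open>p\<close>, and its values on the unit sphere of the two-dimensional \<open>\<ell>\<^sub>p\<close>
  are exactly the points of \<open>E\<^sub>p\<close>.

  Upper bound: the edge term is \<open>|x\<^sub>j|\<^sup>p + |x\<^sub>j\<^sub>+\<^sub>1|\<^sup>p\<close> times a point of \<open>E\<^sub>p\<close>
  (\<open>edge_form_in_E_set\<close>). Each coordinate belongs to at most two edges, so these weights add up
  to at most 2. As \<open>0 \<in> E\<^sub>p\<close>, the missing weight costs nothing, and half of the sum lies in the
  closed convex hull (\<open>edge_sum_in_closed_hull\<close>).

  Lower bound: a vector that alternates between \<open>r\<close> and \<open>s e\<^sup>i\<^sup>\<theta>\<close> on a block of length \<open>2N\<close> has
  the same edge term on all its \<open>2N - 1\<close> inner edges, because \<open>b\<close> is symmetric. After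
  normalisation it gives \<open>(2 - 1/N)\<close> times the prescribed point of \<open>E\<^sub>p\<close>. Placing two such
  vectors side by side, with a zero between them and with weights, produces convex combinations.
  So every point of twice the closed convex hull is approximated by finitely supported unit
  vectors (\<open>closed_hull_approximable\<close>).

  The edge sum does not change under translation, so the approximating vectors can be moved to
  pairwise disjoint supports. Such a sequence is weakly null for \<open>p > 1\<close>
  (\<open>disjoint_supports_weakly_null\<close>): a functional that is at least \<open>\<epsilon>\<close> on \<open>K\<close> of the vectors
  would, after an adjustment of phases, have size at least \<open>K \<epsilon>\<close> on a sum of norm \<open>K\<^sup>1\<^sup>/\<^sup>p\<close>.
  Hence twice the closed convex hull is already reached by the essential numerical range, and
  the trivial inclusion of that range in the closure of \<open>W(T\<^sub>1)\<close> closes the circle. A general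
  \<open>a\<^sub>0 I + c T\<^sub>1\<close> only composes the values with an affine map, under which the compact hull has a
  closed image.
\<close>

section \<open>The edge form\<close>

text \<open>The coordinatewise case distinction in \<open>J\<close> disappears here because the factor \<open>cnj v\<close>
  vanishes at \<open>v = 0\<close>, whatever value the power has there.\<close>

definition edge_form :: "real \<Rightarrow> complex \<Rightarrow> complex \<Rightarrow> complex" where
  "edge_form p u v = u * cnj v * complex_of_real (norm v powr (p - 2))
                   + v * cnj u * complex_of_real (norm u powr (p - 2))"

lemma edge_form_zero [simp]: "edge_form p 0 v = 0" "edge_form p u 0 = 0"
  by (auto simp: edge_form_def)

lemma edge_form_commute: "edge_form p u v = edge_form p v u"
  by (simp add: edge_form_def add.commute)

lemma powr_minus_1_eq:
  fixes t p :: real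
  assumes "0 \<le> t"
  shows "t * t powr (p - 2) = t powr (p - 1)"
  using assms by (simp add: powr_mult_base)

lemma powr_minus_2_eq:
  fixes t p :: real
  assumes "0 \<le> t"
  shows "t * t * t powr (p - 2) = t powr p"
proof -
  have "t * (t * t powr (p - 2)) = t powr p"
    using assms by (simp add: powr_mult_base)
  then show ?thesis by (simp add: mult.assoc)
qed

lemma edge_form_scale:
  assumes "0 \<le> t"
  shows "edge_form p (complex_of_real t * u) (complex_of_real t * v)
         = complex_of_real (t powr p) * edge_form p u v"
proof -
  have "complex_of_real (t powr p) = complex_of_real t * complex_of_real t * complex_of_real (t powr (p - 2))"
    using powr_minus_2_eq[OF assms, of p] by (metis of_real_mult)
  then show ?thesis
    using assms by (simp add: edge_form_def norm_mult powr_mult algebra_simps)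
qed

lemma edge_form_eq_exp:
  assumes "0 \<le> r" "0 \<le> s"
  shows "edge_form p (complex_of_real r) (complex_of_real s * exp (\<i> * complex_of_real \<theta>))
       = complex_of_real (r * s powr (p - 1)) * exp (- (\<i> * complex_of_real \<theta>)) +
         complex_of_real (s * r powr (p - 1)) * exp (\<i> * complex_of_real \<theta>)"
proof -
  have "cnj (exp (\<i> * complex_of_real \<theta>)) = exp (- (\<i> * complex_of_real \<theta>))"
    by (simp add: exp_cnj)
  moreover have "norm (exp (\<i> * complex_of_real \<theta>)) = 1" by simp
  ultimately show ?thesis
    using assms by (simp add: edge_form_def norm_mult
        flip: powr_minus_1_eq[OF assms(1), of p] powr_minus_1_eq[OF assms(2), of p])
qed

lemma E_set_eq_edge_form:
  "E_set p = {edge_form p (complex_of_real r) (complex_of_real s * exp (\<i> * complex_of_real \<theta>)) | r s \<theta>.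
      0 \<le> r \<and> 0 \<le> s \<and> r powr p + s powr p = 1 \<and> 0 \<le> \<theta> \<and> \<theta> \<le> 2 * pi}"
  unfolding E_set_def by (intro Collect_cong) (metis edge_form_eq_exp)

lemma zero_in_E_set: "0 \<in> E_set p"
  unfolding E_set_eq_edge_form
  by (rule CollectI, rule exI[of _ 1], rule exI[of _ 0], rule exI[of _ 0]) simp

text \<open>Rotating both arguments by a common phase does not change \<open>b\<close>, so the first one can be made
  nonnegative, and homogeneity then normalises the pair.\<close>

lemma edge_form_in_E_set:
  assumes "1 < p"
  obtains e where "e \<in> E_set p"
    "edge_form p u v = complex_of_real (norm u powr p + norm v powr p) * e"
proof (cases "u = 0 \<or> v = 0")
  case True
  then show ?thesis using that[OF zero_in_E_set] by auto
next
  case False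
  define m where "m = norm u powr p + norm v powr p"
  define \<rho> where "\<rho> = m powr (1 / p)"
  define \<theta> where "\<theta> = Arg2pi (v * cnj u)"
  have m: "m > 0" using False by (simp add: m_def add_pos_nonneg)
  have \<rho>: "\<rho> > 0" "\<rho> powr p = m" using m assms by (auto simp: \<rho>_def powr_powr)
  let ?r = "norm u / \<rho>" and ?s = "norm v / \<rho>"
  define e where "e = edge_form p (complex_of_real ?r) (complex_of_real ?s * exp (\<i> * complex_of_real \<theta>))"
  have "?r powr p + ?s powr p = 1"
    using \<rho> m by (simp add: powr_divide m_def flip: add_divide_distrib)
  then have "e \<in> E_set p"
    unfolding E_set_eq_edge_form e_def using \<rho> Arg2pi[of "v * cnj u"]
    by (intro CollectI exI[of _ ?r] exI[of _ ?s] exI[of _ \<theta>]) (auto simp: \<theta>_def)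
  moreover have "edge_form p u v = complex_of_real m * e"
  proof -
    have vu: "v * cnj u = complex_of_real (norm u * norm v) * exp (\<i> * complex_of_real \<theta>)"
      using Arg2pi_eq[of "v * cnj u"] by (simp add: \<theta>_def norm_mult mult.commute)
    then have "cnj (v * cnj u) = cnj (complex_of_real (norm u * norm v) * exp (\<i> * complex_of_real \<theta>))"
      by (rule arg_cong)
    then have uv: "u * cnj v = complex_of_real (norm u * norm v) * exp (- (\<i> * complex_of_real \<theta>))"
      by (simp add: exp_cnj mult.commute)
    have "complex_of_real m * e = edge_form p (complex_of_real \<rho> * complex_of_real ?r)
        (complex_of_real \<rho> * (complex_of_real ?s * exp (\<i> * complex_of_real \<theta>)))"
      using \<rho> unfolding e_def by (subst edge_form_scale) auto
    also have "\<dots> = edge_form p (complex_of_real (norm u)) (complex_of_real (norm v) * exp (\<i> * complex_of_real \<theta>))"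
      using \<rho> by simp
    also have "\<dots> = edge_form p u v"
      unfolding edge_form_def uv vu by (simp add: norm_mult exp_cnj algebra_simps)
    finally show ?thesis by simp
  qed
  ultimately show ?thesis using that unfolding m_def by blast
qed

lemma mult_powr_minus_1_le:
  fixes a b p :: real
  assumes "0 \<le> a" "0 \<le> b" "1 < p"
  shows "a * b powr (p - 1) \<le> a powr p + b powr p"
proof -
  define m where "m = max a b"
  have "a * b powr (p - 1) \<le> m * m powr (p - 1)"
    using assms by (intro mult_mono powr_mono2) (auto simp: m_def)
  also have "\<dots> = m powr p" using assms by (simp add: powr_mult_base m_def)
  also have "\<dots> \<le> a powr p + b powr p" by (auto simp: m_def max_def)
  finally show ?thesis .
qed

lemma norm_dual_product_le:
  fixes u v :: complex
  assumes "1 < p"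
  shows "norm (u * cnj v * complex_of_real (norm v powr (p - 2))) \<le> norm u powr p + norm v powr p"
proof -
  have "norm (u * cnj v * complex_of_real (norm v powr (p - 2))) = norm u * norm v powr (p - 1)"
    by (simp add: norm_mult mult.assoc powr_minus_1_eq)
  then show ?thesis using mult_powr_minus_1_le[of "norm u" "norm v" p] assms by simp
qed

lemma norm_edge_form_le:
  assumes "1 < p"
  shows "norm (edge_form p u v) \<le> 2 * (norm u powr p + norm v powr p)"
  using norm_triangle_mono[OF norm_dual_product_le[OF assms, of u v] norm_dual_product_le[OF assms, of v u]]
  by (simp add: edge_form_def)

lemma bounded_E_set:
  assumes "1 < p"
  shows "bounded (E_set p)"
proof (rule boundedI)
  fix z assume "z \<in> E_set p"
  then obtain r s \<theta> where rs: "0 \<le> r" "0 \<le> s" "r powr p + s powr p = 1"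
    and z: "z = edge_form p (complex_of_real r) (complex_of_real s * exp (\<i> * complex_of_real \<theta>))"
    unfolding E_set_eq_edge_form by blast
  show "norm z \<le> 2"
    using norm_edge_form_le[OF assms, of "complex_of_real r"
        "complex_of_real s * exp (\<i> * complex_of_real \<theta>)"] rs z
    by (simp add: norm_mult)
qed

section \<open>Numerical values as sums over edges\<close>

lemma ell_norm_eq_1_iff:
  assumes "0 < p" "x \<in> ell p"
  shows "ell_norm p x = 1 \<longleftrightarrow> (\<lambda>j. norm (x j) powr p) sums 1"
proof -
  have s: "(\<lambda>j. norm (x j) powr p) sums (\<Sum>j. norm (x j) powr p)"
    using assms(2) by (simp add: ell_def summable_sums)
  have nn: "0 \<le> (\<Sum>j. norm (x j) powr p)"
    using assms(2) by (intro suminf_nonneg) (auto simp: ell_def)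
  have "ell_norm p x = 1 \<longleftrightarrow> (\<Sum>j. norm (x j) powr p) = 1"
  proof
    assume "ell_norm p x = 1"
    then have "((\<Sum>j. norm (x j) powr p) powr (1 / p)) powr p = 1" by (simp add: ell_norm_def)
    then show "(\<Sum>j. norm (x j) powr p) = 1" using nn assms(1) by (simp add: powr_powr)
  qed (simp add: ell_norm_def)
  then show ?thesis using s sums_unique by fastforce
qed

text \<open>Shifting the index in the part that comes from \<open>S\<^sub>R\<close> turns the two shift contributions into
  the two halves of the edge terms.\<close>

lemma numerical_value_eq_edge_sum:
  fixes a c :: complex
  assumes p: "1 < p" and x: "(\<lambda>j. norm (x j) powr p) sums 1"
  defines "T \<equiv> (\<lambda>x j. a * x j + c * (shift_right x j + shift_left x j))"
  shows "summable (\<lambda>j. edge_form p (x j) (x (Suc j)))"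
    and "ell_pairing (T x) (duality_map p x) = a + c * (\<Sum>j. edge_form p (x j) (x (Suc j)))"
proof -
  let ?y = "\<lambda>j. cnj (x j) * complex_of_real (norm (x j) powr (p - 2))"
  let ?A = "\<lambda>j. x j * ?y (Suc j)" and ?B = "\<lambda>j. x (Suc j) * ?y j"
  have sx: "summable (\<lambda>j. norm (x j) powr p)" using x by (rule sums_summable)
  then have sx': "summable (\<lambda>j. norm (x (Suc j)) powr p)"
    by (simp add: summable_Suc_iff[of "\<lambda>j. norm (x j) powr p"])
  have dom: "summable (\<lambda>j. norm (x j) powr p + norm (x (Suc j)) powr p)"
    using sx sx' by (rule summable_add)
  have A: "summable ?A"
    by (rule summable_comparison_test'[OF dom, of 0])
       (use norm_dual_product_le[OF p] in \<open>simp add: mult.assoc\<close>)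
  have B: "summable ?B"
    by (rule summable_comparison_test'[OF dom, of 0])
       (use norm_dual_product_le[OF p, of "x (Suc _)" "x _"] in \<open>simp add: mult.assoc add.commute\<close>)
  have ed: "edge_form p (x j) (x (Suc j)) = ?A j + ?B j" for j
    by (simp add: edge_form_def mult.assoc)
  show "summable (\<lambda>j. edge_form p (x j) (x (Suc j)))"
    unfolding ed using A B by (rule summable_add)
  have diag: "(\<lambda>j. x j * ?y j) sums 1"
  proof -
    have "x j * ?y j = complex_of_real (norm (x j) powr p)" for j
    proof -
      have "x j * ?y j = complex_of_real (norm (x j) * norm (x j) * norm (x j) powr (p - 2))"
        by (simp add: mult.assoc[symmetric] complex_norm_square[symmetric] power2_eq_square)
      then show ?thesis by (simp only: powr_minus_2_eq[OF norm_ge_zero])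
    qed
    then show ?thesis using sums_of_real[OF x, where ?'a = complex] by simp
  qed
  have "(\<lambda>j. shift_right x (Suc j) * ?y (Suc j)) sums suminf ?A"
    using A by (simp add: shift_right_def summable_sums)
  from sums_Suc[OF this] have R: "(\<lambda>j. shift_right x j * ?y j) sums suminf ?A"
    by (simp add: shift_right_def)
  have L: "(\<lambda>j. shift_left x j * ?y j) sums suminf ?B"
    using B by (simp add: shift_left_def summable_sums)
  have dm: "cnj (duality_map p x j) = ?y j" for j
    by (simp add: duality_map_def)
  have "(\<lambda>j. a * (x j * ?y j) + c * (shift_right x j * ?y j + shift_left x j * ?y j))
      sums (a * 1 + c * (suminf ?A + suminf ?B))"
    by (intro sums_add sums_mult diag R L)
  moreover have "a * (x j * ?y j) + c * (shift_right x j * ?y j + shift_left x j * ?y j)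
      = T x j * cnj (duality_map p x j)" for j
    by (simp only: dm T_def) (simp add: algebra_simps)
  ultimately have "ell_pairing (T x) (duality_map p x) = a + c * (suminf ?A + suminf ?B)"
    unfolding ell_pairing_def by (simp add: sums_iff)
  also have "suminf ?A + suminf ?B = (\<Sum>j. edge_form p (x j) (x (Suc j)))"
    unfolding ed using A B by (rule suminf_add)
  finally show "ell_pairing (T x) (duality_map p x) = a + c * (\<Sum>j. edge_form p (x j) (x (Suc j)))" .
qed

text \<open>The missing mass \<open>1 - \<Sum>w\<close> is put on the point 0.\<close>

lemma convex_subprobability_sum:
  fixes S :: "'a::real_vector set"
  assumes "convex S" "0 \<in> S" "finite I" "\<And>i. i \<in> I \<Longrightarrow> 0 \<le> w i" "\<And>i. i \<in> I \<Longrightarrow> y i \<in> S"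
    and "sum w I \<le> 1"
  shows "(\<Sum>i\<in>I. w i *\<^sub>R y i) \<in> S"
proof (cases "sum w I = 0")
  case True
  then have "w i = 0" if "i \<in> I" for i
    using that assms(3,4) by (simp add: sum_nonneg_eq_0_iff)
  then show ?thesis using assms(2) by simp
next
  case False
  define W where "W = sum w I"
  have W: "0 < W" "W \<le> 1" using False assms(4,6) by (auto simp: W_def sum_nonneg order.not_eq_order_implies_strict)
  have "(\<Sum>i\<in>I. (w i / W) *\<^sub>R y i) \<in> S"
    using assms W by (intro convex_sum) (auto simp: W_def simp flip: sum_divide_distrib)
  then have "(1 - W) *\<^sub>R 0 + W *\<^sub>R (\<Sum>i\<in>I. (w i / W) *\<^sub>R y i) \<in> S"
    using assms(1,2) W by (intro convexD) auto
  then show ?thesis using W by (simp add: scaleR_sum_right)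
qed

lemma edge_sum_in_closed_hull:
  assumes p: "1 < p" and x: "(\<lambda>j. norm (x j) powr p) sums 1"
    and sm: "summable (\<lambda>j. edge_form p (x j) (x (Suc j)))"
  shows "(\<Sum>j. edge_form p (x j) (x (Suc j))) / 2 \<in> closure (convex hull E_set p)"
proof -
  have "\<forall>j. \<exists>e. e \<in> E_set p \<and> edge_form p (x j) (x (Suc j))
      = complex_of_real (norm (x j) powr p + norm (x (Suc j)) powr p) * e"
    using edge_form_in_E_set[OF p] by metis
  then obtain e where e: "\<And>j. e j \<in> E_set p"
    "\<And>j. edge_form p (x j) (x (Suc j)) = complex_of_real (norm (x j) powr p + norm (x (Suc j)) powr p) * e j"
    by metis
  have part: "(\<Sum>j<n. edge_form p (x j) (x (Suc j))) / 2 \<in> convex hull E_set p" for n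
  proof -
    let ?w = "\<lambda>j. (norm (x j) powr p + norm (x (Suc j)) powr p) / 2"
    have le: "(\<Sum>j\<in>I. norm (x j) powr p) \<le> 1" if "finite I" for I
      using sum_le_suminf[OF sums_summable[OF x] that] sums_unique[OF x] by simp
    have "(\<Sum>j<n. norm (x (Suc j)) powr p) = (\<Sum>j\<in>Suc ` {..<n}. norm (x j) powr p)"
      by (simp add: sum.reindex)
    then have "sum ?w {..<n} \<le> 1"
      using le[of "{..<n}"] le[of "Suc ` {..<n}"]
      by (simp add: sum.distrib flip: sum_divide_distrib)
    then have "(\<Sum>j<n. ?w j *\<^sub>R e j) \<in> convex hull E_set p"
      using e(1) zero_in_E_set
      by (intro convex_subprobability_sum) (auto intro: hull_inc convex_convex_hull)
    also have "(\<Sum>j<n. ?w j *\<^sub>R e j) = (\<Sum>j<n. edge_form p (x j) (x (Suc j))) / 2"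
      by (simp add: e(2) sum_divide_distrib scaleR_conv_of_real)
    finally show ?thesis .
  qed
  have "(\<lambda>n. (\<Sum>j<n. edge_form p (x j) (x (Suc j))) / 2) \<longlonglongrightarrow> (\<Sum>j. edge_form p (x j) (x (Suc j))) / 2"
    using summable_LIMSEQ[OF sm] by (intro tendsto_divide) auto
  with part show ?thesis unfolding closure_sequential
    by (intro exI[of _ "\<lambda>n. (\<Sum>j<n. edge_form p (x j) (x (Suc j))) / 2"]) simp
qed

section \<open>Approximation by finitely supported vectors\<close>

text \<open>The factor 2 reflects that the edge weights of a unit vector add up to at most 2,
  and nearly reach 2 on long flat blocks. Finite
  support leaves room to put several such vectors next to each other.\<close>

definition approximable :: "real \<Rightarrow> complex set" where
  "approximable p = {z. \<forall>\<epsilon>>0. \<exists>x L v. (\<forall>j\<ge>L. x j = 0) \<and> (\<lambda>j. norm (x j) powr p) sums 1 \<and>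
      (\<lambda>j. edge_form p (x j) (x (Suc j))) sums v \<and> norm (v - 2 * z) < \<epsilon>}"

lemma approximableD:
  assumes "z \<in> approximable p" "\<epsilon> > 0"
  obtains x L v where "\<And>j. j \<ge> L \<Longrightarrow> x j = 0" "(\<lambda>j. norm (x j) powr p) sums 1"
    "(\<lambda>j. edge_form p (x j) (x (Suc j))) sums v" "norm (v - 2 * z) < \<epsilon>"
  using assms unfolding approximable_def by blast

definition translate :: "nat \<Rightarrow> (nat \<Rightarrow> complex) \<Rightarrow> nat \<Rightarrow> complex" where
  "translate k x j = (if j < k then 0 else x (j - k))"

lemma translate_norm_sums:
  assumes "(\<lambda>j. norm (x j) powr p) sums m"
  shows "(\<lambda>j. norm (translate k x j) powr p) sums m"
proof (rule sums_iff_shift'[THEN iffD1, of _ k])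
  have "(\<Sum>i<k. norm (translate k x i) powr p) = 0" by (simp add: translate_def)
  then show "(\<lambda>i. norm (translate k x (i + k)) powr p) sums (m - (\<Sum>i<k. norm (translate k x i) powr p))"
    using assms by (simp add: translate_def)
qed

lemma translate_edge_sums:
  assumes "(\<lambda>j. edge_form p (x j) (x (Suc j))) sums v"
  shows "(\<lambda>j. edge_form p (translate k x j) (translate k x (Suc j))) sums v"
proof (rule sums_iff_shift'[THEN iffD1, of _ k])
  have "(\<Sum>i<k. edge_form p (translate k x i) (translate k x (Suc i))) = 0"
    by (simp add: translate_def)
  then show "(\<lambda>i. edge_form p (translate k x (i + k)) (translate k x (Suc (i + k))))
      sums (v - (\<Sum>i<k. edge_form p (translate k x i) (translate k x (Suc i))))"
    using assms by (simp add: translate_def Suc_diff_le)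
qed

text \<open>The two-periodic block: by symmetry of the edge form every inner edge contributes the same
  value, and only the last edge of the block is lost.\<close>

lemma E_set_approximable:
  assumes "1 < p"
  shows "E_set p \<subseteq> approximable p"
proof
  fix z assume "z \<in> E_set p"
  then obtain r s \<theta> where rs: "0 \<le> r" "0 \<le> s" "r powr p + s powr p = 1"
    and z: "z = edge_form p (complex_of_real r) (complex_of_real s * exp (\<i> * complex_of_real \<theta>))"
    unfolding E_set_eq_edge_form by blast
  define u v where "u = complex_of_real r" and "v = complex_of_real s * exp (\<i> * complex_of_real \<theta>)"
  have nuv: "norm u = r" "norm v = s" using rs by (auto simp: u_def v_def norm_mult)
  have zuv: "edge_form p u v = z" "edge_form p v u = z"
    using z edge_form_commute by (auto simp: u_def v_def)
  show "z \<in> approximable p" unfolding approximable_def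
  proof (intro CollectI allI impI)
    fix \<epsilon> :: real assume "\<epsilon> > 0"
    then obtain M :: nat where M: "norm z / \<epsilon> < real M" using reals_Archimedean2 by blast
    define N where "N = Suc M"
    define t where "t = (1 / real N) powr (1 / p)"
    have N: "N > 0" "real N > norm z / \<epsilon>" using M by (auto simp: N_def)
    have t: "t \<ge> 0" "t powr p = 1 / real N" using assms N by (auto simp: t_def powr_powr)
    define x where "x = (\<lambda>j. if j < 2 * N then complex_of_real t * (if even j then u else v) else 0)"
    have fin: "\<forall>j\<ge>2*N. x j = 0" by (simp add: x_def)
    have pair: "(\<Sum>j<2*n. if even j then a else b) = real n * (a + b)" for n and a b :: real
      by (induction n) (auto simp: algebra_simps)
    have mass: "(\<lambda>j. norm (x j) powr p) sums 1"
    proof -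
      have "(\<Sum>j<2*N. norm (x j) powr p) = (\<Sum>j<2*N. if even j then r powr p / N else s powr p / N)"
        using t rs by (intro sum.cong) (auto simp: x_def norm_mult nuv powr_mult)
      also have "\<dots> = 1" unfolding pair using N rs by (simp flip: add_divide_distrib)
      finally show ?thesis
        using sums_finite[of "{..<2*N}" "\<lambda>j. norm (x j) powr p"] fin by simp
    qed
    have edges: "(\<lambda>j. edge_form p (x j) (x (Suc j))) sums (of_nat (2 * N - 1) * (z / of_nat N))"
    proof -
      have "edge_form p (x j) (x (Suc j)) = z / of_nat N" if "j < 2 * N - 1" for j
      proof -
        have "j < 2 * N" "Suc j < 2 * N" using that by auto
        then show ?thesis using t by (simp add: x_def edge_form_scale zuv)
      qed
      then have "(\<Sum>j<2*N-1. edge_form p (x j) (x (Suc j))) = of_nat (2 * N - 1) * (z / of_nat N)"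
        by simp
      moreover have "edge_form p (x j) (x (Suc j)) = 0" if "j \<notin> {..<2*N-1}" for j
        using that by (simp add: x_def)
      ultimately show ?thesis
        using sums_finite[of "{..<2*N-1}" "\<lambda>j. edge_form p (x j) (x (Suc j))"] by simp
    qed
    have "of_nat (2 * N - 1) * (z / of_nat N) - 2 * z = - (z / of_nat N)"
      using N by (simp add: of_nat_diff field_simps)
    moreover have "norm (z / of_nat N) < \<epsilon>"
      using N \<open>\<epsilon> > 0\<close> by (simp add: norm_divide field_simps)
    ultimately show "\<exists>x L v. (\<forall>j\<ge>L. x j = 0) \<and> (\<lambda>j. norm (x j) powr p) sums 1 \<and>
        (\<lambda>j. edge_form p (x j) (x (Suc j))) sums v \<and> norm (v - 2 * z) < \<epsilon>"
      using fin mass edges by (metis norm_minus_cancel)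
  qed
qed

text \<open>Two vectors whose supports are separated by a zero share no edge, so weighted concatenation
  takes convex combinations of edge sums.\<close>

lemma convex_approximable:
  assumes "1 < p"
  shows "convex (approximable p)"
proof (rule convexI)
  fix z z' and a b :: real
  assume z: "z \<in> approximable p" and z': "z' \<in> approximable p"
    and ab: "0 \<le> a" "0 \<le> b" "a + b = 1"
  show "a *\<^sub>R z + b *\<^sub>R z' \<in> approximable p" unfolding approximable_def
  proof (intro CollectI allI impI)
    fix \<epsilon> :: real assume e: "\<epsilon> > 0"
    obtain x L v where x: "\<And>j. j \<ge> L \<Longrightarrow> x j = 0" "(\<lambda>j. norm (x j) powr p) sums 1"
      "(\<lambda>j. edge_form p (x j) (x (Suc j))) sums v" "norm (v - 2 * z) < \<epsilon>"
      by (rule approximableD[OF z e]) (rule that)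
    obtain x' L' v' where x': "\<And>j. j \<ge> L' \<Longrightarrow> x' j = 0" "(\<lambda>j. norm (x' j) powr p) sums 1"
      "(\<lambda>j. edge_form p (x' j) (x' (Suc j))) sums v'" "norm (v' - 2 * z') < \<epsilon>"
      by (rule approximableD[OF z' e]) (rule that)
    define y where "y = translate (Suc L) x'"
    have y: "(\<lambda>j. norm (y j) powr p) sums 1" "(\<lambda>j. edge_form p (y j) (y (Suc j))) sums v'"
      unfolding y_def using x' by (auto intro: translate_norm_sums translate_edge_sums)
    have y0: "y j = 0" if "j \<le> L" for j using that by (simp add: y_def translate_def)
    define s t where "s = a powr (1 / p)" and "t = b powr (1 / p)"
    have s: "s \<ge> 0" "s powr p = a" and t: "t \<ge> 0" "t powr p = b"
      using ab assms by (auto simp: s_def t_def powr_powr)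
    define w where "w = (\<lambda>j. complex_of_real s * x j + complex_of_real t * y j)"
    have "\<forall>j\<ge>Suc L + L'. w j = 0"
      using x(1) x'(1) by (auto simp: w_def y_def translate_def)
    moreover have "(\<lambda>j. norm (w j) powr p) sums 1"
    proof -
      have "norm (w j) powr p = a * norm (x j) powr p + b * norm (y j) powr p" for j
        using x(1)[of j] y0[of j] s t by (cases "j \<le> L") (auto simp: w_def norm_mult powr_mult)
      then show ?thesis using sums_add[OF sums_mult[OF x(2), of a] sums_mult[OF y(1), of b]] ab by simp
    qed
    moreover have "(\<lambda>j. edge_form p (w j) (w (Suc j))) sums (complex_of_real a * v + complex_of_real b * v')"
    proof -
      have "edge_form p (w j) (w (Suc j)) = complex_of_real a * edge_form p (x j) (x (Suc j))
          + complex_of_real b * edge_form p (y j) (y (Suc j))" for j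
      \<comment> \<open>Position \<open>L\<close> is the separating zero: edges below it belong to \<open>x\<close>, the others to \<open>y\<close>.\<close>
      proof (cases "j < L")
        case True
        then have "y j = 0" "y (Suc j) = 0" using y0 by auto
        then show ?thesis using s by (simp add: w_def edge_form_scale)
      next
        case False
        then have "x j = 0" "x (Suc j) = 0" using x(1) by auto
        then show ?thesis using t by (simp add: w_def edge_form_scale)
      qed
      then show ?thesis by (simp add: sums_add sums_mult x(3) y(2))
    qed
    moreover have "norm (complex_of_real a * v + complex_of_real b * v' - 2 * (a *\<^sub>R z + b *\<^sub>R z')) < \<epsilon>"
    proof -
      have "complex_of_real a * v + complex_of_real b * v' - 2 * (a *\<^sub>R z + b *\<^sub>R z')
          = a *\<^sub>R (v - 2 * z) + b *\<^sub>R (v' - 2 * z')"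
        by (simp add: scaleR_conv_of_real algebra_simps)
      moreover have "\<dots> \<in> ball 0 \<epsilon>"
        using x(4) x'(4) ab by (intro convexD convex_ball) auto
      ultimately show ?thesis by simp
    qed
    ultimately show "\<exists>x L v. (\<forall>j\<ge>L. x j = 0) \<and> (\<lambda>j. norm (x j) powr p) sums 1 \<and>
        (\<lambda>j. edge_form p (x j) (x (Suc j))) sums v \<and> norm (v - 2 * (a *\<^sub>R z + b *\<^sub>R z')) < \<epsilon>"
      by (intro exI[of _ w] exI[of _ "Suc L + L'"]
          exI[of _ "complex_of_real a * v + complex_of_real b * v'"] conjI)
  qed
qed

lemma closed_approximable: "closed (approximable p)"
proof -
  have "z \<in> approximable p" if z: "z \<in> closure (approximable p)" for z
    unfolding approximable_def
  proof (intro CollectI allI impI)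
    fix \<epsilon> :: real assume e: "\<epsilon> > 0"
    then obtain z' where z': "z' \<in> approximable p" "dist z' z < \<epsilon> / 4"
      using z closure_approachable[of z] by (meson divide_pos_pos zero_less_numeral)
    obtain x L v where x: "\<And>j. j \<ge> L \<Longrightarrow> x j = 0" "(\<lambda>j. norm (x j) powr p) sums 1"
      "(\<lambda>j. edge_form p (x j) (x (Suc j))) sums v" "norm (v - 2 * z') < \<epsilon> / 2"
      by (rule approximableD[OF z'(1) half_gt_zero[OF e]]) (rule that)
    have "norm (v - 2 * z) \<le> norm (v - 2 * z') + norm (2 * (z' - z))"
      using norm_triangle_ineq[of "v - 2 * z'" "2 * (z' - z)"] by (simp add: algebra_simps)
    also have "norm (2 * (z' - z)) = 2 * norm (z' - z)" by (simp only: norm_mult norm_numeral)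
    also have "norm (v - 2 * z') + 2 * norm (z' - z) < \<epsilon>" using x(4) z'(2) by (simp add: dist_norm)
    finally show "\<exists>x L v. (\<forall>j\<ge>L. x j = 0) \<and> (\<lambda>j. norm (x j) powr p) sums 1 \<and>
        (\<lambda>j. edge_form p (x j) (x (Suc j))) sums v \<and> norm (v - 2 * z) < \<epsilon>"
      using x by (intro exI[of _ x] exI[of _ L] exI[of _ v] conjI allI impI)
  qed
  then show ?thesis using closure_subset_eq by blast
qed

lemma closed_hull_approximable:
  assumes "1 < p"
  shows "closure (convex hull E_set p) \<subseteq> approximable p"
  by (intro closure_minimal hull_minimal E_set_approximable convex_approximable
      closed_approximable assms)

section \<open>Weakly null sequences\<close>

text \<open>Phases turn \<open>\<Sum>\<^sub>n |f(X\<^sub>n)|\<close> over a finite set into a single value of \<open>f\<close>; disjointness of the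
  supports makes the \<open>p\<close>-th powers of the norms add up.\<close>

lemma dual_sum_on_disjoint_supports:
  fixes X :: "nat \<Rightarrow> nat \<Rightarrow> complex"
  assumes p: "1 < p" and f: "f \<in> ell_dual p"
    and X: "\<And>n. (\<lambda>j. norm (X n j) powr p) sums 1"
    and disj: "\<And>m n j. m \<noteq> n \<Longrightarrow> X m j = 0 \<or> X n j = 0"
  obtains C where "0 \<le> C"
    "\<And>F. finite F \<Longrightarrow> (\<Sum>n\<in>F. norm (f (X n))) \<le> C * real (card F) powr (1 / p)"
proof -
  obtain C where C: "\<And>x. x \<in> ell p \<Longrightarrow> norm (f x) \<le> C * ell_norm p x"
    using f by (auto simp: ell_dual_def)
  have add: "f (\<lambda>j. x j + y j) = f x + f y" if "x \<in> ell p" "y \<in> ell p" for x y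
    using f that by (auto simp: ell_dual_def ell_linear_functional_def)
  have scale: "f (\<lambda>j. a * x j) = a * f x" if "x \<in> ell p" for x a
    using f that by (auto simp: ell_dual_def ell_linear_functional_def)
  have Xl: "X n \<in> ell p" for n using sums_summable[OF X] by (simp add: ell_def)
  define a where "a = (\<lambda>n. cnj (sgn (f (X n))))"
  have na: "norm (a n) powr p \<le> 1" for n by (simp add: a_def norm_sgn)
  have af: "a n * f (X n) = complex_of_real (norm (f (X n)))" for n
    by (cases "f (X n) = 0")
       (auto simp: a_def sgn_eq complex_norm_square[symmetric] power2_eq_square mult.commute)
  define y where "y = (\<lambda>F j. \<Sum>n\<in>F. a n * X n j)"
  have main: "\<exists>m \<le> real (card F). (\<lambda>j. norm (y F j) powr p) sums m \<and>
      f (y F) = complex_of_real (\<Sum>n\<in>F. norm (f (X n)))" if "finite F" for F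
    using that
  proof (induction F rule: finite_induct)
    case empty
    have "f (\<lambda>j. 0 * X 0 j) = 0 * f (X 0)" by (rule scale[OF Xl])
    then show ?case by (auto simp: y_def)
  next
    case (insert k F)
    then obtain m where m: "m \<le> real (card F)" "(\<lambda>j. norm (y F j) powr p) sums m"
      "f (y F) = complex_of_real (\<Sum>n\<in>F. norm (f (X n)))" by blast
    have yi: "y (insert k F) = (\<lambda>j. a k * X k j + y F j)"
      using insert by (simp add: y_def)
    have sk: "(\<lambda>j. norm (a k * X k j) powr p) sums (norm (a k) powr p)"
      using sums_mult[OF X[of k], of "norm (a k) powr p"] by (simp add: norm_mult powr_mult)
    have one: "X k j = 0 \<or> y F j = 0" for j
    proof (cases "X k j = 0")
      case False
      then have "X n j = 0" if "n \<in> F" for n using disj[of k n j] that insert by auto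
      then show ?thesis by (simp add: y_def)
    qed simp
    have "norm (y (insert k F) j) powr p = norm (a k * X k j) powr p + norm (y F j) powr p" for j
      unfolding yi using one[of j] by auto
    then have "(\<lambda>j. norm (y (insert k F) j) powr p) sums (norm (a k) powr p + m)"
      using sums_add[OF sk m(2)] by simp
    moreover have "norm (a k) powr p + m \<le> real (card (insert k F))"
      using na[of k] m(1) insert by simp
    moreover have "f (y (insert k F)) = complex_of_real (\<Sum>n\<in>insert k F. norm (f (X n)))"
    proof -
      have "(\<lambda>j. a k * X k j) \<in> ell p" "y F \<in> ell p"
        using sk m(2) by (auto simp: ell_def sums_summable)
      then show ?thesis unfolding yi using insert by (simp add: add scale[OF Xl] af m(3))
    qed
    ultimately show ?case by blast
  qed
  have "(\<Sum>n\<in>F. norm (f (X n))) \<le> \<bar>C\<bar> * real (card F) powr (1 / p)" if F: "finite F" for F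
  proof -
    obtain m where m: "m \<le> real (card F)" "(\<lambda>j. norm (y F j) powr p) sums m"
      "f (y F) = complex_of_real (\<Sum>n\<in>F. norm (f (X n)))" using main[OF F] by blast
    have nn: "0 \<le> m" using sums_le[OF _ sums_zero m(2)] by simp
    have "ell_norm p (y F) = m powr (1 / p)" using m(2) by (simp add: ell_norm_def sums_iff)
    also have "\<dots> \<le> real (card F) powr (1 / p)" using p m(1) nn by (intro powr_mono2) auto
    finally have le: "ell_norm p (y F) \<le> real (card F) powr (1 / p)" .
    have "(\<Sum>n\<in>F. norm (f (X n))) = norm (f (y F))"
      unfolding m(3) norm_of_real by (simp add: sum_nonneg)
    also have "\<dots> \<le> C * ell_norm p (y F)"
      using m(2) by (intro C) (auto simp: ell_def sums_summable)
    also have "\<dots> \<le> \<bar>C\<bar> * real (card F) powr (1 / p)"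
      using le by (intro mult_mono) (auto simp: ell_norm_def)
    finally show ?thesis .
  qed
  then show ?thesis using that[of "\<bar>C\<bar>"] by simp
qed

lemma disjoint_supports_weakly_null:
  assumes p: "1 < p"
    and X: "\<And>n. (\<lambda>j. norm (X n j) powr p) sums 1"
    and disj: "\<And>m n j. m \<noteq> n \<Longrightarrow> X m j = 0 \<or> X n j = 0"
  shows "ell_weakly_null p X"
  unfolding ell_weakly_null_def
proof
  fix f assume f: "f \<in> ell_dual p"
  obtain C where C: "0 \<le> C"
    "\<And>F. finite F \<Longrightarrow> (\<Sum>n\<in>F. norm (f (X n))) \<le> C * real (card F) powr (1 / p)"
    by (rule dual_sum_on_disjoint_supports[where X = X, OF p f X]) (erule disj, rule that)
  have fin: "finite {n. \<not> norm (f (X n)) < \<epsilon>}" if e: "\<epsilon> > 0" for \<epsilon>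
  proof (rule ccontr)
    assume inf: "infinite {n. \<not> norm (f (X n)) < \<epsilon>}"
    have bnd: "real K powr (1 - 1 / p) \<le> C / \<epsilon>" if "K > 0" for K
    proof -
      obtain F where F: "F \<subseteq> {n. \<not> norm (f (X n)) < \<epsilon>}" "finite F" "card F = K"
        using infinite_arbitrarily_large[OF inf] by blast
      have "real K * \<epsilon> \<le> (\<Sum>n\<in>F. norm (f (X n)))"
        using F sum_bounded_below[of F \<epsilon> "\<lambda>n. norm (f (X n))"] by (auto simp: not_less)
      also have "\<dots> \<le> C * real K powr (1 / p)" using C(2)[OF F(2)] F(3) by simp
      finally show ?thesis using that e by (simp add: powr_diff field_simps)
    qed
    \<comment> \<open>The bound fails for large \<open>K\<close> since \<open>p > 1\<close> makes the exponent positive.\<close>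
    define \<alpha> where "\<alpha> = 1 - 1 / p"
    have \<alpha>: "\<alpha> > 0" using p by (simp add: \<alpha>_def)
    obtain K :: nat where K: "(C / \<epsilon> + 1) powr (1 / \<alpha>) < real K" using reals_Archimedean2 by blast
    have pos: "C / \<epsilon> + 1 > 0" using C(1) e by (simp add: add_nonneg_pos)
    have "C / \<epsilon> + 1 = ((C / \<epsilon> + 1) powr (1 / \<alpha>)) powr \<alpha>"
      using pos \<alpha> by (simp add: powr_powr)
    also have "\<dots> \<le> real K powr \<alpha>" using K \<alpha> by (intro powr_mono2) auto
    also have "\<dots> \<le> C / \<epsilon>"
      unfolding \<alpha>_def using K powr_ge_zero[of "C / \<epsilon> + 1" "1 / \<alpha>"] by (intro bnd) linarith
    finally show False by simp
  qed
  show "(\<lambda>n. f (X n)) \<longlonglongrightarrow> 0"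
    unfolding tendsto_iff dist_0_norm cofinite_eq_sequentially[symmetric] eventually_cofinite
    using fin by (simp add: dist_norm)
qed

text \<open>The supports must become disjoint without changing the edge sums: unit vectors approximating \<open>2z\<close> with errors \<open>1/(n+1)\<close> are laid out one after the other along
  the half-line.\<close>

lemma weakly_null_edge_sums:
  assumes p: "1 < p" and z: "z \<in> closure (convex hull E_set p)"
  obtains X v where "\<And>n. (\<lambda>j. norm (X n j) powr p) sums 1" "ell_weakly_null p X"
    "\<And>n. (\<lambda>j. edge_form p (X n j) (X n (Suc j))) sums v n" "v \<longlonglongrightarrow> 2 * z"
proof -
  have "\<forall>n. \<exists>x L v. (\<forall>j\<ge>L. x j = 0) \<and> (\<lambda>j. norm (x j) powr p) sums 1 \<and>
      (\<lambda>j. edge_form p (x j) (x (Suc j))) sums v \<and> norm (v - 2 * z) < inverse (real (Suc n))"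
    using closed_hull_approximable[OF p] z unfolding approximable_def by auto
  then obtain x L v where xLv: "\<forall>n. (\<forall>j\<ge>L n. x n j = 0) \<and> (\<lambda>j. norm (x n j) powr p) sums 1 \<and>
      (\<lambda>j. edge_form p (x n j) (x n (Suc j))) sums v n \<and> norm (v n - 2 * z) < inverse (real (Suc n))"
    unfolding choice_iff by (elim exE)
  then have x: "\<And>n j. j \<ge> L n \<Longrightarrow> x n j = 0" "\<And>n. (\<lambda>j. norm (x n j) powr p) sums 1"
       "\<And>n. (\<lambda>j. edge_form p (x n j) (x n (Suc j))) sums v n"
       "\<And>n. norm (v n - 2 * z) < inverse (real (Suc n))"
    by auto
  define k where "k = (\<lambda>n. \<Sum>i<n. L i)"
  define X where "X = (\<lambda>n. translate (k n) (x n))"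
  have X: "(\<lambda>j. norm (X n j) powr p) sums 1" for n
    unfolding X_def by (rule translate_norm_sums[OF x(2)])
  have supp: "X n j = 0" if "j < k n \<or> k (Suc n) \<le> j" for n j
    using that x(1)[of n "j - k n"] by (auto simp: X_def translate_def k_def)
  have mono: "k (Suc m) \<le> k n" if "m < n" for m n
    unfolding k_def using that by (intro sum_mono2) auto
  have lt: "X m j = 0 \<or> X n j = 0" if "m < n" for m n j
    using supp[of j m] supp[of j n] mono[OF that] by linarith
  have disj: "X m j = 0 \<or> X n j = 0" if "m \<noteq> n" for m n j
    using lt[of m n j] lt[of n m j] that by linarith
  have "v \<longlonglongrightarrow> 2 * z"
  proof (rule LIM_zero_cancel, rule tendsto_norm_zero_cancel)
    show "(\<lambda>n. norm (v n - 2 * z)) \<longlonglongrightarrow> 0"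
      by (rule tendsto_sandwich[OF _ _ tendsto_const LIMSEQ_inverse_real_of_nat])
         (use less_imp_le[OF x(4)] in auto)
  qed
  moreover have "(\<lambda>j. edge_form p (X n j) (X n (Suc j))) sums v n" for n
    unfolding X_def by (rule translate_edge_sums[OF x(3)])
  ultimately show ?thesis
    using that[of X v] X disjoint_supports_weakly_null[of p X, OF p X disj] by blast
qed

section \<open>The numerical ranges\<close>

lemma ess_numerical_range_subset_closure:
  "ess_numerical_range p T \<subseteq> closure (numerical_range p T)"
proof
  fix z assume "z \<in> ess_numerical_range p T"
  then obtain X where "\<And>n. X n \<in> ell p \<and> ell_norm p (X n) = 1"
    "(\<lambda>n. ell_pairing (T (X n)) (duality_map p (X n))) \<longlonglongrightarrow> z"
    unfolding ess_numerical_range_def by blast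
  then show "z \<in> closure (numerical_range p T)"
    unfolding closure_sequential numerical_range_def
    by (intro exI[of _ "\<lambda>n. ell_pairing (T (X n)) (duality_map p (X n))"]) blast
qed

lemma numerical_ranges_shift_combination:
  fixes a c :: complex
  assumes p: "1 < p"
  defines "T \<equiv> (\<lambda>x j. a * x j + c * (shift_right x j + shift_left x j))"
  shows "ess_numerical_range p T = closure (numerical_range p T)"
    and "closure (numerical_range p T) = (\<lambda>z. a + 2 * c * z) ` closure (convex hull E_set p)"
proof -
  let ?H = "(\<lambda>z. a + 2 * c * z) ` closure (convex hull E_set p)"
  have "compact (closure (convex hull E_set p))"
    using bounded_E_set[OF p] by (simp add: compact_closure bounded_convex_hull)
  then have "closed ?H"
    by (intro compact_imp_closed compact_continuous_image continuous_intros)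
  moreover have "numerical_range p T \<subseteq> ?H"
  proof
    fix w assume "w \<in> numerical_range p T"
    then obtain x where x: "x \<in> ell p" "ell_norm p x = 1"
      and w: "w = ell_pairing (T x) (duality_map p x)"
      unfolding numerical_range_def by blast
    have x1: "(\<lambda>j. norm (x j) powr p) sums 1" using ell_norm_eq_1_iff[of p x] x p by simp
    define V where "V = (\<Sum>j. edge_form p (x j) (x (Suc j)))"
    have "w = a + 2 * c * (V / 2)"
      using numerical_value_eq_edge_sum(2)[OF p x1, of a c] by (simp add: w T_def V_def)
    then show "w \<in> ?H"
      using edge_sum_in_closed_hull[OF p x1 numerical_value_eq_edge_sum(1)[OF p x1]]
      unfolding V_def by blast
  qed
  ultimately have upper: "closure (numerical_range p T) \<subseteq> ?H" by (intro closure_minimal)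
  have lower: "?H \<subseteq> ess_numerical_range p T"
  proof
    fix w assume "w \<in> ?H"
    then obtain z where z: "z \<in> closure (convex hull E_set p)" and w: "w = a + 2 * c * z" by blast
    obtain X v where X: "\<And>n. (\<lambda>j. norm (X n j) powr p) sums 1" "ell_weakly_null p X"
      "\<And>n. (\<lambda>j. edge_form p (X n j) (X n (Suc j))) sums v n" "v \<longlonglongrightarrow> 2 * z"
      by (rule weakly_null_edge_sums[OF p z]) (rule that)
    have Xl: "X n \<in> ell p" for n using sums_summable[OF X(1)] by (simp add: ell_def)
    have "ell_pairing (T (X n)) (duality_map p (X n)) = a + c * v n" for n
      using numerical_value_eq_edge_sum(2)[OF p X(1)[of n], of a c] sums_unique[OF X(3)[of n]]
      by (simp add: T_def)
    moreover have "(\<lambda>n. a + c * v n) \<longlonglongrightarrow> a + c * (2 * z)"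
      by (intro tendsto_intros X(4))
    ultimately have "(\<lambda>n. ell_pairing (T (X n)) (duality_map p (X n))) \<longlonglongrightarrow> w"
      by (simp add: w mult_ac)
    moreover have "ell_norm p (X n) = 1" for n
      using ell_norm_eq_1_iff[of p "X n"] X(1) Xl p by simp
    ultimately show "w \<in> ess_numerical_range p T"
      unfolding ess_numerical_range_def using Xl X(2) by blast
  qed
  show "ess_numerical_range p T = closure (numerical_range p T)"
    "closure (numerical_range p T) = ?H"
    using upper lower ess_numerical_range_subset_closure[of p T] by blast+
qed

theorem theorem4p5:
  fixes p :: real and a0 c :: complex
    and T T1 :: "(nat \<Rightarrow> complex) \<Rightarrow> (nat \<Rightarrow> complex)"
  assumes "1 < p"
    and "T = (\<lambda>x j. a0 * x j + c * (shift_right x j + shift_left x j))"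
    and "T1 = (\<lambda>x j. shift_right x j + shift_left x j)"
  shows "(ess_numerical_range p T = closure (numerical_range p T) \<and>
          closure (numerical_range p T)
            = (\<lambda>z. a0 + 2 * c * z) ` closure (convex hull (E_set p))) \<and>
         (ess_numerical_range p T1 = closure (numerical_range p T1) \<and>
          closure (numerical_range p T1)
            = (\<lambda>z. 2 * z) ` closure (convex hull (E_set p)))"
  using numerical_ranges_shift_combination[OF assms(1), of a0 c]
    numerical_ranges_shift_combination[OF assms(1), of 0 1]
  by (simp add: assms(2,3))

end
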